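(* Let $p,q\ge 0$ be integers with $p+q\ge 2$. The action of $O(p+1,q+1)$ on $N^{p,q}$ preserves $\hat{\mathcal H}_d$, the set of $d$-dimensional conformal quadratic surfaces in $N^{p,q}$, for each $d=1,\dots,p+q-1$. Furthermore, two conformal quadratic surfaces $H,H'\in\hat{\mathcal H}_d$ are in the same $O(p+1,q+1)$-orbit if and only if there exist projective subspaces $h,h'\subset\mathbb{R}P^{p+q+1}$ of dimension $d+1$ such that $H=N^{p,q}\cap h$, $H'=N^{p,q}\cap h'$, and the restrictions $\hat Q|_h$ and $\hat Q|_{h'}$ have the same signature.
   Context: $\mathbb{R}^{p+1,q+1}$ is $\mathbb{R}^{p+q+2}$ with coordinates $\xi=(\xi_0,\dots,\xi_{p+q+1})$ and quadratic form $\hat Q(\xi)=\xi_0^2+\xi_1^2+\cdots+\xi_p^2-\xi_{p+1}^2-\cdots-\xi_{p+q+1}^2$. $O(p+1,q+1)$ is the group of invertible linear maps of $\mathbb{R}^{p+q+2}$ preserving $\hat Q$. $N^{p,q}=\{[\xi]\in\mathbb{R}P^{p+q+1}:\hat Q(\xi)=0\}$, on which $O(p+1,q+1)$ acts through its linear action. For $d=1,\dots,p+q-1$, a $d$-dimensional conformal quadratic surface in $N^{p,q}$ is an intersection $N^{p,q}\cap h$, where $h$ is a projective subspace of dimension $d+1$ in $\mathbb{R}P^{p+q+1}$, provided that this intersection indeed has dimension $d$. The set of these is denoted $\hat{\mathcal H}_d$. (The subspace $h$ need not be uniquely determined by $N^{p,q}\cap h$.) $\hat Q|_h$ denotes the restriction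 of $\hat Q$ to the $(d+2)$-dimensional linear subspace of $\mathbb{R}^{p+1,q+1}$ underlying $h$; it may be degenerate. Its signature records the numbers of positive, negative and zero entries in a diagonalization. *)

theory Defs
  imports "HOL-Analysis.Analysis"
begin

text \<open>A point of the projective space of a Euclidean space \<open>'v\<close> is a line through the origin,
  represented as the set of vectors on it; \<open>span {x}\<close> is the point \<open>[x]\<close> for \<open>x \<noteq> 0\<close>.
  Sets of points carry the topology induced from the quotient topology of \<open>'v - {0}\<close>.\<close>

definition proj_space :: "('v::euclidean_space) set set" where
  "proj_space = {span {x} | x. x \<noteq> 0}"

definition proj_topology :: "('v::euclidean_space) set topology" where
  "proj_topology = topology (\<lambda>U. U \<subseteq> proj_space \<and> open {x. x \<noteq> 0 \<and> span {x} \<in> U})"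

lemma openin_proj_topology:
  "openin proj_topology U \<longleftrightarrow> U \<subseteq> proj_space \<and> open {x. x \<noteq> 0 \<and> span {x} \<in> U}"
proof -
  have "istopology (\<lambda>U :: 'a set set. U \<subseteq> proj_space \<and> open {x. x \<noteq> 0 \<and> span {x} \<in> U})"
  proof -
    have "open {x. x \<noteq> 0 \<and> span {x} \<in> S \<inter> T}"
      if "open {x. x \<noteq> 0 \<and> span {x} \<in> S}" "open {x. x \<noteq> 0 \<and> span {x} \<in> T}" for S T :: "'a set set"
    proof -
      have "{x. x \<noteq> 0 \<and> span {x} \<in> S \<inter> T}
          = {x. x \<noteq> 0 \<and> span {x} \<in> S} \<inter> {x. x \<noteq> 0 \<and> span {x} \<in> T}"
        by auto
      then show ?thesis
        using open_Int[OF that] by (simp only:)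
    qed
    moreover have "open {x. x \<noteq> 0 \<and> span {x} \<in> \<Union>\<K>}"
      if "\<forall>K\<in>\<K>. open {x. x \<noteq> 0 \<and> span {x} \<in> K}" for \<K> :: "'a set set set"
    proof -
      have "{x. x \<noteq> 0 \<and> span {x} \<in> \<Union>\<K>} = (\<Union>K\<in>\<K>. {x. x \<noteq> 0 \<and> span {x} \<in> K})"
        by auto
      then show ?thesis
        using open_UN[OF that] by (simp only:)
    qed
    ultimately show ?thesis
      unfolding istopology_def by (simp add: Sup_le_iff le_infI1)
  qed
  then show ?thesis
    by (simp add: proj_topology_def)
qed

lemma quotient_map_proj_topology:
  "quotient_map (top_of_set (- {0})) proj_topology (\<lambda>x :: 'v::euclidean_space. span {x})"
proof -
  have top: "topspace (proj_topology :: 'v set topology) = proj_space"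
  proof -
    have "{x :: 'v. x \<noteq> 0 \<and> span {x} \<in> proj_space} = - {0}"
      by (auto simp: proj_space_def)
    then have "openin proj_topology (proj_space :: 'v set set)"
      by (simp only: openin_proj_topology open_Compl closed_singleton subset_refl)
    then show ?thesis
      using openin_topspace[of "proj_topology :: 'v set topology"]
      by (intro equalityI openin_subset) (simp only: openin_proj_topology)
  qed
  have "{x. x \<in> topspace (top_of_set (- {0})) \<and> span {x} \<in> U} = {x. x \<noteq> 0 \<and> span {x} \<in> U}"
    for U :: "'v set set"
    by auto
  moreover have "openin (top_of_set (- {0 :: 'v})) S \<longleftrightarrow> open S \<and> S \<subseteq> - {0}" for S
    by (intro openin_open_eq open_Compl closed_singleton)
  moreover have "(\<lambda>x :: 'v. span {x}) ` topspace (top_of_set (- {0})) = proj_space"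
    by (auto simp: proj_space_def)
  ultimately show ?thesis
    unfolding quotient_map_def top openin_proj_topology by (simp only:) auto
qed

definition proj_subspaces :: "nat \<Rightarrow> ('v::euclidean_space) set set set" where
  "proj_subspaces k = {{L \<in> proj_space. L \<subseteq> W} | W. subspace W \<and> dim W = k + 1}"

definition underlying :: "('v::euclidean_space) set set \<Rightarrow> 'v set" where
  "underlying h = \<Union>h"

lemma underlying_proj_subspace:
  assumes "subspace W" "W \<noteq> {0}"
  shows "underlying {L \<in> proj_space. L \<subseteq> W} = W"
proof (intro equalityI subsetI)
  fix x assume x: "x \<in> W"
  obtain y where y: "y \<in> W" "y \<noteq> 0"
    using assms subspace_0 by blast
  define z where "z = (if x = 0 then y else x)"
  have "span {z} \<in> proj_space" "span {z} \<subseteq> W"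
    using x y span_minimal[OF _ assms(1), of "{z}"] by (auto simp: z_def proj_space_def)
  moreover have "x \<in> span {z}"
    by (auto simp: z_def span_zero span_base)
  ultimately show "x \<in> underlying {L \<in> proj_space. L \<subseteq> W}"
    unfolding underlying_def by blast
qed (auto simp: underlying_def)

definition proj_image :: "('v \<Rightarrow> 'v) \<Rightarrow> ('v::euclidean_space) set set \<Rightarrow> 'v set set" where
  "proj_image g H = (\<lambda>L. g ` L) ` H"

text \<open>Dimension of a set of points, by means of the small inductive dimension. For a real
  projective algebraic set it coincides with the dimension as a real algebraic set.\<close>

definition has_proj_dimension :: "('v::euclidean_space) set set \<Rightarrow> nat \<Rightarrow> bool" where
  "has_proj_dimension S d \<longleftrightarrow>
     subtopology proj_topology S dim_le int d \<and>
     \<not> subtopology proj_topology S dim_le int d - 1"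

text \<open>The numbers of positive, negative and zero diagonal entries, with respect to a basis of
  \<open>W\<close> that diagonalizes the restriction of \<open>Q\<close>. By Sylvester's law they do not depend on the
  choice of the basis.\<close>

definition has_signature ::
    "('v::euclidean_space \<Rightarrow> real) \<Rightarrow> 'v set \<Rightarrow> nat \<times> nat \<times> nat \<Rightarrow> bool" where
  "has_signature Q W s \<longleftrightarrow>
     (\<exists>B. independent B \<and> span B = W \<and>
          (\<forall>c. Q (\<Sum>b\<in>B. c b *\<^sub>R b) = (\<Sum>b\<in>B. Q b * (c b)\<^sup>2)) \<and>
          s = (card {b \<in> B. Q b > 0}, card {b \<in> B. Q b < 0}, card {b \<in> B. Q b = 0}))"

text \<open>The space \<open>\<real>\<^bsup>p+1,q+1\<^esup>\<close> is \<open>real ^ ('a + 'b)\<close> with \<open>CARD('a) = p + 1\<close> and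
  \<open>CARD('b) = q + 1\<close>; the coordinates indexed by \<open>'a\<close> are the positive ones.\<close>

definition Qhat :: "real ^ ('a::finite + 'b::finite) \<Rightarrow> real" where
  "Qhat \<xi> = (\<Sum>i\<in>UNIV. (\<xi> $ Inl i)\<^sup>2) - (\<Sum>j\<in>UNIV. (\<xi> $ Inr j)\<^sup>2)"

definition O_group :: "(real ^ ('a::finite + 'b::finite) \<Rightarrow> real ^ ('a + 'b)) set" where
  "O_group = {g. linear g \<and> bij g \<and> (\<forall>\<xi>. Qhat (g \<xi>) = Qhat \<xi>)}"

definition N_quadric :: "(real ^ ('a::finite + 'b::finite)) set set" where
  "N_quadric = {span {\<xi>} | \<xi>. \<xi> \<noteq> 0 \<and> Qhat \<xi> = 0}"

definition conf_quadratic_surfaces :: "nat \<Rightarrow> (real ^ ('a::finite + 'b::finite)) set set set" where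
  "conf_quadratic_surfaces d =
     {N_quadric \<inter> h | h. h \<in> proj_subspaces (d + 1) \<and> has_proj_dimension (N_quadric \<inter> h) d}"

end

theory Submission
  imports Defs
begin

text \<open>An element \<open>g\<close> of \<open>O(p+1,q+1)\<close> acts on projective space by a homeomorphism that maps the
  quadric to itself and permutes the projective subspaces of each dimension. It therefore permutes
  the sections of the quadric by projective subspaces, and it preserves their topological dimension;
  this is the invariance of the set of \<open>d\<close>-dimensional conformal quadratic surfaces.

  If \<open>H' = g H\<close> and \<open>H = N \<inter> h\<close>, then \<open>H' = N \<inter> g h\<close>, and \<open>g\<close> transports a diagonalizing basis of
  the subspace under \<open>h\<close> to one of the subspace under \<open>g h\<close>. So the two restrictions of the form
  have a common signature, as soon as there is a diagonalizing basis at all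
  (\<open>orthogonal_basis_exists\<close>).

  Conversely, let the restrictions to \<open>W\<close> and \<open>W'\<close> have the same signature. A bijection between
  diagonalizing bases that respects the signs becomes, after rescaling, a linear isometry of \<open>W\<close>
  onto \<open>W'\<close>, and Witt's theorem (\<open>isometry_extension\<close>) extends it to an isometry of the whole
  space, which is the required element of the group. The subspaces may be degenerate, so Witt's
  theorem is needed in its full form. It is proved by induction on a basis: it is enough to find an
  isometry that fixes a given set \<open>S\<close> and moves \<open>u\<close> to \<open>v\<close>, where \<open>u\<close> and \<open>v\<close> have the same
  square and the same products with \<open>S\<close> (\<open>isometry_moving_one_vector\<close>). With \<open>n = v - u\<close>, which
  is orthogonal to \<open>S\<close>, an explicit isometry does this in each of three cases: the reflection in
  \<open>n\<close> if \<open>n\<close> is not isotropic, otherwise an Eichler transvection along \<open>n\<close>, or, if \<open>u\<close> lies in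
  the span of \<open>S\<close> and \<open>n\<close>, a rescaling of a hyperbolic plane through \<open>n\<close>.\<close>

section \<open>Symmetric bilinear forms and their diagonalization\<close>

locale symmetric_form =
  fixes B :: "'v::euclidean_space \<Rightarrow> 'v \<Rightarrow> real"
  assumes bilinear_form: "bilinear B"
    and form_commute: "B x y = B y x"
begin

lemmas form_simps =
  bilinear_ladd[OF bilinear_form] bilinear_radd[OF bilinear_form]
  bilinear_lsub[OF bilinear_form] bilinear_rsub[OF bilinear_form]
  bilinear_lmul[OF bilinear_form] bilinear_rmul[OF bilinear_form]
  bilinear_lzero[OF bilinear_form] bilinear_rzero[OF bilinear_form]

lemma polarization: "B x y = (B (x + y) (x + y) - B x x - B y y) / 2"
  using form_commute[of x y] by (simp add: form_simps)

lemma orthogonal_span: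
  assumes "\<And>s. s \<in> S \<Longrightarrow> B s w = 0" and "x \<in> span S"
  shows "B x w = 0"
  using assms(2)
proof (induction rule: span_induct_alt)
  case base
  show ?case by (simp add: form_simps)
next
  case (step c x y)
  then show ?case by (simp add: form_simps assms(1))
qed

text \<open>If some vector \<open>w\<close> of \<open>W\<close> is not isotropic, then \<open>W\<close> is the sum of the line of \<open>w\<close> and
  its orthogonal complement in \<open>W\<close>, to which the induction hypothesis applies. Otherwise the
  form vanishes on \<open>W\<close> by polarization, and every basis is orthogonal.\<close>

lemma orthogonal_basis_exists:
  assumes "subspace W"
  shows "\<exists>C. independent C \<and> span C = W \<and> pairwise (\<lambda>x y. B x y = 0) C"
  using assms
proof (induction "dim W" arbitrary: W rule: less_induct)
  case less
  show ?case
  proof (cases "\<exists>w\<in>W. B w w \<noteq> 0")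
    case False
    obtain C where C: "C \<subseteq> W" "independent C" "W \<subseteq> span C"
      using basis_exists[of W] by metis
    have "span C = W"
      using C less.prems by (simp add: span_minimal subset_antisym)
    moreover have "B x y = 0" if "x \<in> C" "y \<in> C" for x y
    proof -
      have "x \<in> W" "y \<in> W" "x + y \<in> W"
        using C(1) that subspace_add[OF less.prems] by auto
      then show ?thesis
        using False by (subst polarization) simp
    qed
    ultimately show ?thesis
      using C(2) by (auto simp: pairwise_def)
  next
    case True
    then obtain w where w: "w \<in> W" "B w w \<noteq> 0" by blast
    define U where "U = {x \<in> W. B x w = 0}"
    have U: "subspace U"
      using less.prems by (auto simp: U_def subspace_def form_simps)
    have "U \<subset> W"
      using w by (auto simp: U_def)
    then have "dim U < dim W"
      using U less.prems by (metis dim_psubset span_eq_iff)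
    then obtain C where C: "independent C" "span C = U" "pairwise (\<lambda>x y. B x y = 0) C"
      using less.hyps U by blast
    have "w \<notin> span C"
      using w C(2) by (simp add: U_def)
    then have "independent (insert w C)"
      using C(1) by (simp add: independent_insert)
    moreover have "span (insert w C) = W"
    proof (intro equalityI subsetI)
      fix x assume "x \<in> span (insert w C)"
      then obtain k where k: "x - k *\<^sub>R w \<in> U"
        using C(2) by (auto simp: span_breakdown_eq)
      then have "(x - k *\<^sub>R w) + k *\<^sub>R w \<in> W"
        using w by (intro subspace_add subspace_scale less.prems) (auto simp: U_def)
      then show "x \<in> W" by simp
    next
      fix x assume "x \<in> W"
      then have "x - (B x w / B w w) *\<^sub>R w \<in> U"
        using w by (auto simp: U_def form_simps intro!: subspace_diff subspace_scale less.prems)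
      then show "x \<in> span (insert w C)"
        using C(2) by (auto simp: span_breakdown_eq)
    qed
    moreover have "pairwise (\<lambda>x y. B x y = 0) (insert w C)"
    proof -
      have "B x w = 0" "B w x = 0" if "x \<in> C" for x
        using span_base[OF that] C(2) by (simp_all add: U_def form_commute[of w x])
      then show ?thesis
        using C(3) by (simp add: pairwise_insert)
    qed
    ultimately show ?thesis by blast
  qed
qed

lemma quadratic_form_sum_orthogonal:
  assumes "finite C" "pairwise (\<lambda>x y. B x y = 0) C"
  shows "B (\<Sum>b\<in>C. c b *\<^sub>R b) (\<Sum>b\<in>C. c b *\<^sub>R b) = (\<Sum>b\<in>C. B b b * (c b)\<^sup>2)"
  using assms
proof (induction C rule: finite_induct)
  case empty
  show ?case by (simp add: form_simps)
next
  case (insert x F)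
  have "B y x = 0" if "y \<in> F" for y
    using insert.prems insert.hyps that by (auto simp: pairwise_insert)
  then have "B (\<Sum>b\<in>F. c b *\<^sub>R b) x = 0"
    by (rule orthogonal_span[of F]) (auto intro!: span_sum span_scale intro: span_base)
  moreover from this have "B x (\<Sum>b\<in>F. c b *\<^sub>R b) = 0"
    by (simp add: form_commute[of x "\<Sum>b\<in>F. c b *\<^sub>R b"])
  ultimately show ?case
    using insert by (simp add: form_simps pairwise_insert power2_eq_square)
qed

text \<open>The diagonal shape of the quadratic form is compared with orthogonality by evaluating it
  at the sum of two basis vectors.\<close>

lemma has_signature_iff_orthogonal_basis:
  "has_signature (\<lambda>x. B x x) W s \<longleftrightarrow>
     (\<exists>C. independent C \<and> span C = W \<and> pairwise (\<lambda>x y. B x y = 0) C \<and>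
          s = (card {b \<in> C. B b b > 0}, card {b \<in> C. B b b < 0}, card {b \<in> C. B b b = 0}))"
proof -
  have "(\<forall>c. B (\<Sum>b\<in>C. c b *\<^sub>R b) (\<Sum>b\<in>C. c b *\<^sub>R b) = (\<Sum>b\<in>C. B b b * (c b)\<^sup>2))
      \<longleftrightarrow> pairwise (\<lambda>x y. B x y = 0) C" (is "?diagonal \<longleftrightarrow> _") if C: "independent C" for C
  proof
    have fin: "finite C"
      using C by (rule independent_imp_finite)
    show "pairwise (\<lambda>x y. B x y = 0) C" if ?diagonal
    proof (rule pairwiseI)
      fix x y assume xy: "x \<in> C" "y \<in> C" "x \<noteq> y"
      define c :: "'v \<Rightarrow> real" where "c b = (if b \<in> {x, y} then 1 else 0)" for b
      have "(\<Sum>b\<in>C. c b *\<^sub>R b) = (\<Sum>b\<in>{x, y}. b)"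
        using xy by (intro sum.mono_neutral_cong_right fin) (auto simp: c_def)
      moreover have "(\<Sum>b\<in>C. B b b * (c b)\<^sup>2) = (\<Sum>b\<in>{x, y}. B b b)"
        using xy by (intro sum.mono_neutral_cong_right fin) (auto simp: c_def)
      ultimately have "B (x + y) (x + y) = B x x + B y y"
        using that[rule_format, of c] xy(3) by simp
      then show "B x y = 0"
        by (simp add: polarization[of x y])
    qed
    show ?diagonal if "pairwise (\<lambda>x y. B x y = 0) C"
      using quadratic_form_sum_orthogonal[OF fin that] by blast
  qed
  then show ?thesis
    unfolding has_signature_def by blast
qed

corollary signature_exists:
  assumes "subspace W"
  shows "\<exists>s. has_signature (\<lambda>x. B x x) W s"
  using orthogonal_basis_exists[OF assms] by (auto simp: has_signature_iff_orthogonal_basis)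

text \<open>Only isometry on the squares of vectors is asked for; polarization gives the rest.\<close>

definition isometry :: "('v \<Rightarrow> 'v) \<Rightarrow> bool" where
  "isometry g \<longleftrightarrow> linear g \<and> (\<forall>x. B (g x) (g x) = B x x)"

lemma isometry_form:
  assumes "isometry g"
  shows "B (g x) (g y) = B x y"
proof -
  have "B (g x + g y) (g x + g y) = B (x + y) (x + y)"
    using assms by (simp add: isometry_def flip: linear_add)
  then show ?thesis
    using assms polarization[of x y] polarization[of "g x" "g y"] by (simp add: isometry_def)
qed

lemma isometry_comp: "isometry f \<Longrightarrow> isometry g \<Longrightarrow> isometry (f \<circ> g)"
  by (simp add: isometry_def linear_compose)

lemma has_signature_isometry_image:
  assumes g: "isometry g" and "inj g" and "has_signature (\<lambda>x. B x x) W s"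
  shows "has_signature (\<lambda>x. B x x) (g ` W) s"
proof -
  obtain C where C: "independent C" "span C = W" "pairwise (\<lambda>x y. B x y = 0) C"
    and s: "s = (card {b \<in> C. B b b > 0}, card {b \<in> C. B b b < 0}, card {b \<in> C. B b b = 0})"
    using assms(3) unfolding has_signature_iff_orthogonal_basis by blast
  have lin: "linear g"
    using g by (simp add: isometry_def)
  have card: "card {b \<in> g ` C. P (B b b)} = card {b \<in> C. P (B b b)}" for P
  proof -
    have "{b \<in> g ` C. P (B b b)} = g ` {b \<in> C. P (B b b)}"
      using g by (auto simp: isometry_def)
    then show ?thesis
      using \<open>inj g\<close> by (simp add: card_image inj_on_subset)
  qed
  have "independent (g ` C)"
    using linear_independent_injective_image[OF lin C(1)] \<open>inj g\<close> by (simp add: inj_on_subset)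
  moreover have "span (g ` C) = g ` W"
    using C(2) linear_span_image[OF lin, of C] by simp
  moreover have "pairwise (\<lambda>x y. B x y = 0) (g ` C)"
    using C(3) by (auto simp: pairwise_def isometry_form[OF g])
  ultimately show ?thesis
    unfolding has_signature_iff_orthogonal_basis s
    using card[of "\<lambda>r. r > 0"] card[of "\<lambda>r. r < 0"] card[of "\<lambda>r. r = 0"]
    by (intro exI[of _ "g ` C"]) simp
qed

end

section \<open>Witt's theorem for nondegenerate forms\<close>

locale nondegenerate_form = symmetric_form +
  assumes nondegenerate: "(\<And>y. B x y = 0) \<Longrightarrow> x = 0"
begin

lemma isometry_bij:
  assumes g: "isometry g"
  shows "bij g"
proof -
  have lin: "linear g"
    using g by (simp add: isometry_def)
  have "inj g"
  proof -
    have "x = 0" if "g x = 0" for x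
      using isometry_form[OF g, of x] that by (intro nondegenerate) (simp add: form_simps)
    then show ?thesis
      using linear_injective_0[OF lin] by blast
  qed
  then show ?thesis
    using linear_injective_imp_surjective[OF lin] by (simp add: bij_def)
qed

lemma isometry_inv:
  assumes g: "isometry g"
  shows "isometry (inv g)"
  using g isometry_bij[OF g]
  by (metis isometry_def bij_inv_eq_iff inj_linear_imp_inv_linear bij_is_inj)

text \<open>Nondegeneracy says that each linear functional is of the form \<open>x \<mapsto> B x w\<close>; it is applied to
  the inner product with the component of \<open>x\<close> that is perpendicular to the span of \<open>S\<close>.\<close>

lemma separating_vector:
  assumes "x \<notin> span S"
  obtains w where "B x w = 1" and "\<And>s. s \<in> S \<Longrightarrow> B s w = 0"
proof -
  define J where "J y = (\<Sum>b\<in>Basis. B b y *\<^sub>R b)" for y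
  have BJ: "B a y = a \<bullet> J y" for a y
  proof -
    have "linear (\<lambda>a. B a y)"
      using bilinear_form by (simp add: bilinear_def)
    then have "B a y = (\<Sum>b\<in>Basis. (a \<bullet> b) *\<^sub>R B b y)"
      using linear_sum[of "\<lambda>a. B a y" "\<lambda>b. (a \<bullet> b) *\<^sub>R b" Basis]
      by (simp add: euclidean_representation form_simps)
    then show ?thesis
      by (simp add: J_def inner_sum_right mult.commute)
  qed
  have "linear J"
    by (auto simp: J_def form_simps algebra_simps sum.distrib scaleR_sum_right intro!: linearI)
  moreover have "y = 0" if "J y = 0" for y
    using that BJ by (intro nondegenerate) (metis form_commute inner_zero_right)
  ultimately have "surj J"
    using linear_injective_0[of J] linear_injective_imp_surjective[of J] by auto
  obtain y z where yz: "y \<in> span S" "\<And>s. s \<in> span S \<Longrightarrow> orthogonal z s" "x = y + z"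
    using orthogonal_subspace_decomp_exists by metis
  have "z \<noteq> 0"
    using assms yz by auto
  moreover have "x \<bullet> z = z \<bullet> z"
    using yz(2)[OF yz(1)] yz(3) by (simp add: inner_add_left orthogonal_def inner_commute[of y])
  ultimately have xz: "x \<bullet> z \<noteq> 0" by simp
  obtain w where w: "J w = (1 / (x \<bullet> z)) *\<^sub>R z"
    using \<open>surj J\<close> by (metis surjD)
  show thesis
  proof
    show "B x w = 1"
      using xz by (simp add: BJ w)
    show "B s w = 0" if "s \<in> S" for s
      using yz(2)[OF span_base[OF that]] by (simp add: BJ w orthogonal_def inner_commute)
  qed
qed

lemma isometry_reflection:
  assumes "B n n \<noteq> 0"
  shows "isometry (\<lambda>x. x - (2 * B x n / B n n) *\<^sub>R n)"
  unfolding isometry_def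
proof (intro conjI allI linearI)
  fix x
  show "B (x - (2 * B x n / B n n) *\<^sub>R n) (x - (2 * B x n / B n n) *\<^sub>R n) = B x x"
    using assms by (simp add: form_simps form_commute[of n x] field_simps)
qed (auto simp: form_simps algebra_simps add_divide_distrib)

lemma isometry_transvection:
  assumes "B n n = 0" "B n w = 0"
  shows "isometry (\<lambda>x. x + (B x w - B w w * B x n / 2) *\<^sub>R n - B x n *\<^sub>R w)"
  unfolding isometry_def
proof (intro conjI allI linearI)
  fix x
  let ?y = "x + (B x w - B w w * B x n / 2) *\<^sub>R n - B x n *\<^sub>R w"
  show "B ?y ?y = B x x"
    using assms
    by (simp add: form_simps form_commute[of n x] form_commute[of w x] form_commute[of w n]
        algebra_simps)
qed (auto simp: form_simps algebra_simps add_divide_distrib)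

text \<open>The map \<open>n \<mapsto> k n\<close>, \<open>w \<mapsto> w / k\<close> of a hyperbolic plane, extended by the identity of its
  orthogonal complement.\<close>

lemma isometry_hyperbolic_scaling:
  assumes "B n n = 0" "B w w = 0" "B n w = 1" "k \<noteq> 0"
  shows "isometry (\<lambda>x. x + ((k - 1) * B x w) *\<^sub>R n + ((1 / k - 1) * B x n) *\<^sub>R w)"
  unfolding isometry_def
proof (intro conjI allI linearI)
  fix x
  let ?y = "x + ((k - 1) * B x w) *\<^sub>R n + ((1 / k - 1) * B x n) *\<^sub>R w"
  have "B ?y ?y = B x x + 2 * (B x n * B x w) * ((k - 1) + (1 / k - 1) + (k - 1) * (1 / k - 1))"
    using assms(1-3)
    by (simp add: form_simps form_commute[of n x] form_commute[of w x] form_commute[of w n])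
      (use assms(4) in \<open>simp add: field_simps\<close>)
  also have "(k - 1) + (1 / k - 1) + (k - 1) * (1 / k - 1) = 0"
    using assms(4) by (simp add: field_simps)
  finally show "B ?y ?y = B x x" by simp
qed (auto simp: form_simps algebra_simps)

text \<open>If \<open>n\<close> is isotropic, then \<open>u \<mapsto> u + n\<close> has to be realized by an isometry that adds to each
  vector a multiple of \<open>n\<close> and a multiple of a second vector \<open>w\<close> orthogonal to \<open>S\<close>. A \<open>w\<close> that is
  orthogonal to \<open>n\<close> but not to \<open>u\<close> exists unless \<open>u\<close> lies in the span of \<open>n\<close> and \<open>S\<close>; in that
  case \<open>n\<close> itself is outside the span of \<open>S\<close>, and it only has to be rescaled.\<close>

lemma isometry_moving_one_vector:
  assumes u: "u \<notin> span S" and v: "v \<notin> span S"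
    and uv: "\<And>s. s \<in> S \<Longrightarrow> B s u = B s v" "B u u = B v v"
  obtains g where "isometry g" and "\<And>s. s \<in> S \<Longrightarrow> g s = s" and "g u = v"
proof -
  define n where "n = v - u"
  have Sn: "B s n = 0" if "s \<in> S" for s
    using uv(1)[OF that] by (simp add: n_def form_simps)
  have Bnn: "B n n = - 2 * B u n"
    using uv(2) form_commute[of u v] by (simp add: n_def form_simps)
  consider (anisotropic) "B n n \<noteq> 0"
    | (outside) "B n n = 0" "u \<notin> span (insert n S)"
    | (inside) "B n n = 0" "u \<in> span (insert n S)"
    by blast
  then show thesis
  proof cases
    case anisotropic
    show thesis
    proof (rule that[OF isometry_reflection[OF anisotropic]])
      have "2 * B u n / B n n = - 1"
        using anisotropic Bnn by (simp add: field_simps)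
      then show "u - (2 * B u n / B n n) *\<^sub>R n = v"
        by (simp add: n_def)
    qed (simp add: Sn)
  next
    case outside
    obtain w where w: "B u w = 1" "\<And>s. s \<in> insert n S \<Longrightarrow> B s w = 0"
      using separating_vector[OF outside(2)] by metis
    show thesis
    proof (rule that[OF isometry_transvection[of n w]])
      show "u + (B u w - B w w * B u n / 2) *\<^sub>R n - B u n *\<^sub>R w = v"
        using w(1) outside(1) Bnn by (simp add: n_def)
    qed (use outside w in \<open>simp_all add: Sn\<close>)
  next
    case inside
    then obtain c where c: "u - c *\<^sub>R n \<in> span S"
      by (auto simp: span_breakdown_eq)
    define h where "h = u - c *\<^sub>R n"
    have h: "h \<in> span S" "u = h + c *\<^sub>R n" "v = h + (c + 1) *\<^sub>R n"
      using c by (simp_all add: h_def) (simp add: n_def algebra_simps)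
    have c_nonzero: "c \<noteq> 0" "c + 1 \<noteq> 0"
      using u v h by auto
    have n: "n \<notin> span S"
      using u h by (auto intro: span_add span_scale)
    obtain w0 where w0: "B n w0 = 1" "\<And>s. s \<in> S \<Longrightarrow> B s w0 = 0"
      using separating_vector[OF n] by metis
    \<comment> \<open>Adding a multiple of \<open>n\<close> makes \<open>w0\<close> isotropic without changing its products with
      \<open>n\<close> and \<open>S\<close>.\<close>
    define w where "w = w0 - (B w0 w0 / 2) *\<^sub>R n"
    have w: "B n w = 1" "B w w = 0" "\<And>s. s \<in> S \<Longrightarrow> B s w = 0"
      using w0 inside(1) form_commute[of n w0] by (simp_all add: w_def form_simps Sn)
    \<comment> \<open>Since \<open>h\<close> is fixed, \<open>c n\<close> has to go to \<open>(c + 1) n\<close>.\<close>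
    define k where "k = 1 + 1 / c"
    have k: "k \<noteq> 0" "(k - 1) * c = 1"
      using c_nonzero by (simp_all add: k_def field_simps)
    have "B h w = 0"
      using orthogonal_span[OF w(3) h(1)] .
    then have "B u w = c"
      using w(1) by (simp add: h(2) form_simps)
    show thesis
    proof (rule that[OF isometry_hyperbolic_scaling[OF inside(1) w(2,1) k(1)]])
      show "u + ((k - 1) * B u w) *\<^sub>R n + ((1 / k - 1) * B u n) *\<^sub>R w = v"
        using \<open>B u w = c\<close> k(2) Bnn inside(1) by (simp add: n_def)
    qed (use w in \<open>simp_all add: Sn\<close>)
  qed
qed

text \<open>Witt's theorem. To add \<open>u\<close> to the basis, an isometry that already agrees with \<open>f\<close> on the
  basis is precomposed with one that fixes the basis and moves \<open>u\<close> to the preimage of \<open>f u\<close>.\<close>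

theorem isometry_extension:
  assumes "finite S" "independent S" "inj_on f S" "independent (f ` S)"
    and "\<And>x y. x \<in> S \<Longrightarrow> y \<in> S \<Longrightarrow> B (f x) (f y) = B x y"
  shows "\<exists>g. isometry g \<and> (\<forall>x\<in>S. g x = f x)"
  using assms
proof (induction S rule: finite_induct)
  case empty
  have "isometry id"
    by (simp add: isometry_def linear_id)
  then show ?case by auto
next
  case (insert u S)
  have "independent S" "independent (f ` S)" "u \<notin> span S"
    using insert by (auto simp: independent_insert intro: independent_mono)
  moreover have fu: "f u \<notin> span (f ` S)"
    using insert by (simp add: independent_insert)
  ultimately obtain g where g: "isometry g" "\<And>x. x \<in> S \<Longrightarrow> g x = f x"
    using insert by (auto simp: inj_on_insert)
  have lin: "linear g"
    using g(1) by (simp add: isometry_def)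
  have "surj g"
    using isometry_bij[OF g(1)] by (rule bij_is_surj)
  then obtain v where v: "g v = f u"
    by (metis surjD)
  have "g ` S = f ` S"
    using g(2) by simp
  then have "v \<notin> span S"
    using fu linear_span_image[OF lin, of S] v by (metis imageI)
  moreover have "B s u = B s v" if "s \<in> S" for s
    using isometry_form[OF g(1), of s v] insert.prems(4)[of s u] that g(2)[OF that] v by simp
  moreover have "B u u = B v v"
    using isometry_form[OF g(1), of v v] insert.prems(4)[of u u] v by simp
  ultimately obtain t where t: "isometry t" "\<And>s. s \<in> S \<Longrightarrow> t s = s" "t u = v"
    using isometry_moving_one_vector[OF \<open>u \<notin> span S\<close>] by metis
  have "isometry (g \<circ> t)"
    using g(1) t(1) by (rule isometry_comp)
  moreover have "\<forall>x\<in>insert u S. (g \<circ> t) x = f x"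
    using t g(2) v by simp
  ultimately show ?case by blast
qed

text \<open>Orthogonal bases with the same numbers of positive, negative and isotropic vectors are matched
  by a bijection \<open>f\<close> that respects the sign, and rescaling the images makes it isometric.\<close>

theorem isometry_between_subspaces_of_equal_signature:
  assumes "has_signature (\<lambda>x. B x x) W s" and "has_signature (\<lambda>x. B x x) W' s"
  obtains g where "isometry g" and "g ` W = W'"
proof -
  obtain C where C: "independent C" "span C = W" "pairwise (\<lambda>x y. B x y = 0) C"
    and s: "s = (card {b \<in> C. B b b > 0}, card {b \<in> C. B b b < 0}, card {b \<in> C. B b b = 0})"
    using assms(1) unfolding has_signature_iff_orthogonal_basis by blast
  obtain C' where C': "independent C'" "span C' = W'" "pairwise (\<lambda>x y. B x y = 0) C'"
    and s': "s = (card {b \<in> C'. B b b > 0}, card {b \<in> C'. B b b < 0}, card {b \<in> C'. B b b = 0})"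
    using assms(2) unfolding has_signature_iff_orthogonal_basis by blast
  have fin: "finite C" "finite C'"
    using C C' independent_imp_finite by blast+
  have "\<exists>f. bij_betw f {b \<in> C. sgn (B b b) = e} {b \<in> C'. sgn (B b b) = e}" if "e \<in> {1, -1, 0}" for e
  proof (rule finite_same_card_bij)
    show "card {b \<in> C. sgn (B b b) = e} = card {b \<in> C'. sgn (B b b) = e}"
      using that s s' by (auto simp: sgn_1_pos sgn_1_neg sgn_0_0)
  qed (use fin in auto)
  then have "\<forall>e\<in>{1, -1, 0}. \<exists>f. bij_betw f {b \<in> C. sgn (B b b) = e} {b \<in> C'. sgn (B b b) = e}"
    by blast
  from bchoice[OF this] obtain F where F: "\<And>e. e \<in> {1, -1, 0} \<Longrightarrow>
      bij_betw (F e) {b \<in> C. sgn (B b b) = e} {b \<in> C'. sgn (B b b) = e}"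
    by blast
  define f where "f b = F (sgn (B b b)) b" for b
  have sgn_cases: "sgn r \<in> {1, -1, 0}" for r :: real
    by (simp add: sgn_real_def)
  have f: "f b \<in> C'" "sgn (B (f b) (f b)) = sgn (B b b)" if "b \<in> C" for b
    using bij_betwE[OF F[OF sgn_cases[of "B b b"]]] that by (auto simp: f_def)
  have f_inj: "inj_on f C"
  proof (rule inj_onI)
    fix x y assume xy: "x \<in> C" "y \<in> C" "f x = f y"
    then have "sgn (B x x) = sgn (B y y)"
      using f by metis
    then show "x = y"
      using xy bij_betw_imp_inj_on[OF F[OF sgn_cases[of "B x x"]]]
      by (auto simp: f_def inj_on_def)
  qed
  have f_surj: "f ` C = C'"
  proof (intro equalityI subsetI)
    fix y assume "y \<in> C'"
    then have "y \<in> F (sgn (B y y)) ` {b \<in> C. sgn (B b b) = sgn (B y y)}"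
      using bij_betw_imp_surj_on[OF F[OF sgn_cases[of "B y y"]]] by simp
    then obtain x where "x \<in> C" "sgn (B x x) = sgn (B y y)" "y = F (sgn (B y y)) x"
      by blast
    then have "x \<in> C" "y = f x"
      by (simp_all add: f_def)
    then show "y \<in> f ` C"
      by blast
  qed (use f in auto)
  have card: "card C = card C'"
    using card_image[OF f_inj] f_surj by simp

  define r where "r b = (if B b b = 0 then 1 else sqrt (B b b / B (f b) (f b)))" for b
  have ratio: "B b b / B (f b) (f b) > 0" if "b \<in> C" "B b b \<noteq> 0" for b
    using f(2)[OF that(1)] that(2) by (auto simp: sgn_real_def zero_less_divide_iff split: if_splits)
  have r: "r b \<noteq> 0" "(r b)\<^sup>2 * B (f b) (f b) = B b b" if "b \<in> C" for b
  proof -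
    show "r b \<noteq> 0"
      using ratio[OF that] by (cases "B b b = 0") (auto simp: r_def)
    show "(r b)\<^sup>2 * B (f b) (f b) = B b b"
    proof (cases "B b b = 0")
      case True
      then show ?thesis
        using f(2)[OF that] by (simp add: r_def sgn_0_0)
    next
      case False
      then show ?thesis
        using ratio[OF that False] by (auto simp: r_def)
    qed
  qed
  define f' where "f' b = r b *\<^sub>R f b" for b
  have span_f': "span (f' ` C) = W'"
  proof
    show "span (f' ` C) \<subseteq> W'"
      using f(1) C'(2) by (intro span_minimal) (auto simp: f'_def intro: span_scale span_base)
    have "f b \<in> span (f' ` C)" if "b \<in> C" for b
    proof -
      have "f b = (1 / r b) *\<^sub>R f' b"
        using r(1)[OF that] by (simp add: f'_def)
      then show ?thesis
        using that by (metis imageI span_base span_scale)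
    qed
    then have "C' \<subseteq> span (f' ` C)"
      using f_surj by auto
    then show "W' \<subseteq> span (f' ` C)"
      using C'(2) span_minimal[OF _ subspace_span] by metis
  qed
  have dim: "dim (span (f' ` C)) = card C"
    using C' card span_f' by (metis dim_span_eq_card_independent)
  have card_f': "card (f' ` C) \<le> card C"
    using fin by (intro card_image_le)
  have isometric: "B (f' x) (f' y) = B x y" if "x \<in> C" "y \<in> C" for x y
  proof (cases "x = y")
    case True
    then show ?thesis
      using r(2)[OF that(1)] by (simp add: f'_def form_simps power2_eq_square mult.assoc)
  next
    case False
    then have "f x \<noteq> f y"
      using f_inj that by (auto simp: inj_on_def)
    then show ?thesis
      using C(3) C'(3) False f(1) that by (simp add: f'_def form_simps pairwise_def)
  qed
  have "independent (f' ` C)"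
    by (rule card_le_dim_spanning[of _ "span (f' ` C)"])
      (use dim card_f' fin in \<open>auto intro: span_base\<close>)
  moreover from this have "inj_on f' C"
    using dim fin by (intro eq_card_imp_inj_on) (simp_all add: dim_eq_card_independent)
  ultimately obtain g where g: "isometry g" "\<forall>x\<in>C. g x = f' x"
    using isometry_extension[OF fin(1) C(1)] isometric by metis
  have "g ` W = span (g ` C)"
    using g(1) C(2) by (metis isometry_def linear_span_image)
  also have "g ` C = f' ` C"
    using g(2) by simp
  finally have "g ` W = W'"
    using span_f' by simp
  then show thesis
    using that g(1) by blast
qed

end

section \<open>Linear maps acting on projective space\<close>

lemma topspace_proj_topology: "topspace proj_topology = proj_space"
proof -
  have "(\<lambda>x. span {x}) ` topspace (top_of_set (- {0})) = topspace proj_topology"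
    using quotient_map_proj_topology by (rule quotient_imp_surjective_map)
  then show ?thesis
    by (auto simp: proj_space_def)
qed

lemma linear_image_line: "linear g \<Longrightarrow> g ` span {x} = span {g x}"
  using linear_span_image[of g "{x}"] by (simp only: image_insert image_empty)

lemma linear_image_proj_space:
  assumes "linear g" "inj g" "L \<in> proj_space"
  shows "g ` L \<in> proj_space"
proof -
  obtain x where "x \<noteq> 0" "L = span {x}"
    using assms(3) by (auto simp: proj_space_def)
  moreover from this have "g x \<noteq> 0"
    using assms(1,2) linear_injective_0 by blast
  ultimately show ?thesis
    using linear_image_line[OF assms(1), of x] unfolding proj_space_def by blast
qed

lemma continuous_map_linear_image:
  fixes g :: "'v::euclidean_space \<Rightarrow> 'v"
  assumes g: "linear g" "inj g"
  shows "continuous_map proj_topology proj_topology (image g)"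
  unfolding continuous_map_def topspace_proj_topology openin_proj_topology
proof (intro conjI allI impI)
  show "image g \<in> proj_space \<rightarrow> proj_space"
    using linear_image_proj_space[OF g] by auto
  fix U :: "'v set set" assume U: "U \<subseteq> proj_space \<and> open {x. x \<noteq> 0 \<and> span {x} \<in> U}"
  have "g x = 0 \<longleftrightarrow> x = 0" for x
    using linear_injective_0[OF g(1)] g(2) linear_0[OF g(1)] by blast
  moreover have "span {x} \<in> proj_space" if "x \<noteq> 0" for x :: 'v
    using that unfolding proj_space_def by blast
  ultimately have "{x. x \<noteq> 0 \<and> span {x} \<in> {L \<in> proj_space. g ` L \<in> U}}
      = g -` {x. x \<noteq> 0 \<and> span {x} \<in> U}"
    by (auto simp: linear_image_line[OF g(1)])
  moreover have "open (g -` {x. x \<noteq> 0 \<and> span {x} \<in> U})"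
    using U g(1) by (intro open_vimage linear_continuous_on linear_conv_bounded_linear[THEN iffD1]) auto
  ultimately show "open {x. x \<noteq> 0 \<and> span {x} \<in> {L \<in> proj_space. g ` L \<in> U}}"
    by simp
qed auto

lemma has_proj_dimension_proj_image:
  assumes g: "linear g" "bij g" and S: "S \<subseteq> proj_space"
  shows "has_proj_dimension (proj_image g S) d \<longleftrightarrow> has_proj_dimension S d"
proof -
  have inv: "linear (inv g)" "inj (inv g)"
    using g by (auto simp: inj_linear_imp_inv_linear bij_is_inj bij_imp_bij_inv)
  have "homeomorphic_maps proj_topology proj_topology (image g) (image (inv g))"
    unfolding homeomorphic_maps_def
  proof (intro conjI ballI)
    show "inv g ` g ` L = L" "g ` inv g ` L = L" for L
      using g(2) by (simp_all add: image_inv_f_f image_f_inv_f bij_is_inj bij_is_surj)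
  qed (use g inv in \<open>simp_all add: continuous_map_linear_image bij_is_inj\<close>)
  moreover have "image g ` (topspace proj_topology \<inter> S) = topspace proj_topology \<inter> proj_image g S"
    using S linear_image_proj_space[OF g(1) bij_is_inj[OF g(2)]]
    by (auto simp: topspace_proj_topology proj_image_def)
  ultimately have "subtopology proj_topology S homeomorphic_space
      subtopology proj_topology (proj_image g S)"
    using homeomorphic_maps_subtopologies[of _ _ "image g" "image (inv g)" S "proj_image g S"]
    unfolding homeomorphic_space_def by blast
  note homeomorphic_space_dimension_le[OF this]
  then show ?thesis
    unfolding has_proj_dimension_def by blast
qed

lemma proj_image_lines_in_subspace:
  assumes g: "linear g" "bij g"
  shows "proj_image g {L \<in> proj_space. L \<subseteq> W} = {L \<in> proj_space. L \<subseteq> g ` W}"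
proof (intro equalityI subsetI)
  fix L assume "L \<in> proj_image g {L \<in> proj_space. L \<subseteq> W}"
  then show "L \<in> {L \<in> proj_space. L \<subseteq> g ` W}"
    using linear_image_proj_space[OF g(1) bij_is_inj[OF g(2)]] by (auto simp: proj_image_def)
next
  fix L assume L: "L \<in> {L \<in> proj_space. L \<subseteq> g ` W}"
  have inv: "linear (inv g)" "inj (inv g)"
    using g by (auto simp: inj_linear_imp_inv_linear bij_is_inj bij_imp_bij_inv)
  have L_eq: "L = g ` inv g ` L"
    using g(2) by (simp add: image_f_inv_f bij_is_surj)
  have "inv g ` L \<subseteq> inv g ` g ` W"
    using L by (intro image_mono) simp
  then have "inv g ` L \<subseteq> W"
    using g(2) by (simp add: image_inv_f_f bij_is_inj)
  moreover have "inv g ` L \<in> proj_space"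
    using L linear_image_proj_space[OF inv] by simp
  ultimately have "inv g ` L \<in> {L \<in> proj_space. L \<subseteq> W}"
    by simp
  with L_eq show "L \<in> proj_image g {L \<in> proj_space. L \<subseteq> W}"
    unfolding proj_image_def by (rule image_eqI)
qed

lemma proj_image_Int:
  assumes "inj g"
  shows "proj_image g (S \<inter> T) = proj_image g S \<inter> proj_image g T"
  unfolding proj_image_def by (intro image_Int injI) (metis assms inj_image_eq_iff)

section \<open>The quadric and its isometry group\<close>

definition polar_form :: "real ^ ('a::finite + 'b::finite) \<Rightarrow> real ^ ('a + 'b) \<Rightarrow> real" where
  "polar_form x y = (\<Sum>i\<in>UNIV. x $ Inl i * y $ Inl i) - (\<Sum>j\<in>UNIV. x $ Inr j * y $ Inr j)"

lemma Qhat_eq_polar_form: "Qhat = (\<lambda>x. polar_form x x)"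
  by (simp add: fun_eq_iff Qhat_def polar_form_def power2_eq_square)

interpretation polar: nondegenerate_form "polar_form :: real ^ ('a::finite + 'b::finite) \<Rightarrow> _"
proof
  show "bilinear (polar_form :: real ^ ('a + 'b) \<Rightarrow> _)"
    by (auto simp: bilinear_def polar_form_def algebra_simps sum.distrib sum_distrib_left
        intro!: linearI)
  show "polar_form x y = polar_form y x" for x y :: "real ^ ('a + 'b)"
    by (simp add: polar_form_def mult.commute)
  show "x = 0" if "\<And>y. polar_form x y = 0" for x :: "real ^ ('a + 'b)"
  proof -
    have left: "x $ Inl i = 0" for i
      using that[of "axis (Inl i) 1"]
      by (simp add: polar_form_def axis_def if_distrib[of "(*) _"] cong: if_cong)
    have right: "x $ Inr j = 0" for j
      using that[of "axis (Inr j) 1"]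
      by (simp add: polar_form_def axis_def if_distrib[of "(*) _"] cong: if_cong)
    have "x $ k = 0" for k
      using left right by (cases k) auto
    then show ?thesis
      by (simp add: vec_eq_iff)
  qed
qed

lemma O_group_iff_isometry: "g \<in> O_group \<longleftrightarrow> polar.isometry g"
  using polar.isometry_bij by (auto simp: O_group_def polar.isometry_def Qhat_eq_polar_form)

lemma O_groupD:
  assumes "g \<in> O_group"
  shows "linear g" "bij g" "Qhat (g \<xi>) = Qhat \<xi>"
  using assms by (auto simp: O_group_def)

lemma inv_in_O_group: "g \<in> O_group \<Longrightarrow> inv g \<in> O_group"
  by (simp add: O_group_iff_isometry polar.isometry_inv)

lemma N_quadric_subset_proj_space: "N_quadric \<subseteq> proj_space"
  by (auto simp: N_quadric_def proj_space_def)

lemma proj_image_N_quadric_subset: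
  assumes "g \<in> O_group"
  shows "proj_image g N_quadric \<subseteq> N_quadric"
proof
  fix L assume "L \<in> proj_image g N_quadric"
  then obtain \<xi> where \<xi>: "L = g ` span {\<xi>}" "\<xi> \<noteq> 0" "Qhat \<xi> = 0"
    by (auto simp: proj_image_def N_quadric_def)
  moreover have "g \<xi> \<noteq> 0"
    using \<xi>(2) O_groupD(1,2)[OF assms] by (metis bij_is_inj linear_injective_0)
  ultimately show "L \<in> N_quadric"
    unfolding N_quadric_def using O_groupD[OF assms] by (auto simp: linear_image_line)
qed

lemma proj_image_inv:
  assumes "g \<in> O_group"
  shows "proj_image g (proj_image (inv g) S) = S"
  using O_groupD(2)[OF assms] by (auto simp: proj_image_def image_image surj_f_inv_f bij_is_surj)

lemma proj_image_N_quadric: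
  assumes "g \<in> O_group"
  shows "proj_image g N_quadric = N_quadric"
proof
  have "proj_image g (proj_image (inv g) N_quadric) \<subseteq> proj_image g N_quadric"
    using proj_image_N_quadric_subset[OF inv_in_O_group[OF assms]]
    by (simp add: proj_image_def image_mono)
  then show "N_quadric \<subseteq> proj_image g N_quadric"
    by (simp add: proj_image_inv[OF assms])
qed (rule proj_image_N_quadric_subset[OF assms])

lemma proj_image_quadric_section:
  assumes "g \<in> O_group"
  shows "proj_image g (N_quadric \<inter> h) = N_quadric \<inter> proj_image g h"
  using O_groupD(2)[OF assms] by (simp add: proj_image_Int bij_is_inj proj_image_N_quadric[OF assms])

lemma proj_subspacesE:
  assumes "h \<in> proj_subspaces k"
  obtains W where "h = {L \<in> proj_space. L \<subseteq> W}" "subspace W" "dim W = k + 1" "underlying h = W"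
proof -
  obtain W where W: "h = {L \<in> proj_space. L \<subseteq> W}" "subspace W" "dim W = k + 1"
    using assms by (auto simp: proj_subspaces_def)
  then have "W \<noteq> {0}" by auto
  then show thesis
    using that W underlying_proj_subspace[OF W(2)] by simp
qed

lemma proj_image_proj_subspaces:
  assumes g: "linear g" "bij g" and "h \<in> proj_subspaces k"
  shows "proj_image g h \<in> proj_subspaces k" "underlying (proj_image g h) = g ` underlying h"
proof -
  obtain W where W: "h = {L \<in> proj_space. L \<subseteq> W}" "subspace W" "dim W = k + 1" "underlying h = W"
    using assms(3) by (rule proj_subspacesE)
  have gW: "subspace (g ` W)" "dim (g ` W) = k + 1"
    using W g dim_image_eq[OF g(1), of W] inj_on_subset[OF bij_is_inj[OF g(2)], of "span W"]
    by (simp_all add: linear_subspace_image)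
  have gh: "proj_image g h = {L \<in> proj_space. L \<subseteq> g ` W}"
    using W(1) proj_image_lines_in_subspace[OF g] by simp
  then show "proj_image g h \<in> proj_subspaces k"
    using gW unfolding proj_subspaces_def by blast
  have "g ` W \<noteq> {0}"
    using gW(2) by auto
  then show "underlying (proj_image g h) = g ` underlying h"
    using gh W(4) underlying_proj_subspace[OF gW(1)] by simp
qed

lemma proj_image_conf_quadratic_surface:
  assumes g: "g \<in> O_group" and "H \<in> conf_quadratic_surfaces d"
  shows "proj_image g H \<in> conf_quadratic_surfaces d"
proof -
  obtain h where h: "H = N_quadric \<inter> h" "h \<in> proj_subspaces (d + 1)" "has_proj_dimension H d"
    using assms(2) by (auto simp: conf_quadratic_surfaces_def)
  have "H \<subseteq> proj_space"
    using h(1) N_quadric_subset_proj_space by blast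
  then have "has_proj_dimension (proj_image g H) d"
    using h(3) O_groupD[OF g] by (simp add: has_proj_dimension_proj_image)
  then show ?thesis
    using proj_image_quadric_section[OF g, of h] h(1)
      proj_image_proj_subspaces(1)[OF O_groupD(1,2)[OF g] h(2)]
    by (auto simp: conf_quadratic_surfaces_def)
qed

theorem theorem20:
  fixes p q d :: nat
  assumes "CARD('a::finite) = p + 1" and "CARD('b::finite) = q + 1"
    and "p + q \<ge> 2"
    and "d \<in> {1..p + q - 1}"
  shows "(\<forall>g \<in> (O_group :: (real ^ ('a + 'b) \<Rightarrow> real ^ ('a + 'b)) set).
            proj_image g ` conf_quadratic_surfaces d = conf_quadratic_surfaces d) \<and>
         (\<forall>H \<in> (conf_quadratic_surfaces d :: (real ^ ('a + 'b)) set set set).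
          \<forall>H' \<in> conf_quadratic_surfaces d.
            (\<exists>g \<in> O_group. H' = proj_image g H) \<longleftrightarrow>
            (\<exists>h \<in> proj_subspaces (d + 1). \<exists>h' \<in> proj_subspaces (d + 1).
               H = N_quadric \<inter> h \<and> H' = N_quadric \<inter> h' \<and>
               (\<exists>s. has_signature Qhat (underlying h) s \<and> has_signature Qhat (underlying h') s)))"
proof (intro conjI ballI iffI)
  fix g :: "real ^ ('a + 'b) \<Rightarrow> real ^ ('a + 'b)" assume g: "g \<in> O_group"
  show "proj_image g ` conf_quadratic_surfaces d = conf_quadratic_surfaces d"
  proof (intro equalityI subsetI)
    fix H assume "H \<in> proj_image g ` conf_quadratic_surfaces d"
    then show "H \<in> conf_quadratic_surfaces d"
      using proj_image_conf_quadratic_surface[OF g] by blast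
  next
    fix H :: "(real ^ ('a + 'b)) set set" assume "H \<in> conf_quadratic_surfaces d"
    then have "proj_image (inv g) H \<in> conf_quadratic_surfaces d"
      by (rule proj_image_conf_quadratic_surface[OF inv_in_O_group[OF g]])
    then show "H \<in> proj_image g ` conf_quadratic_surfaces d"
      using proj_image_inv[OF g, of H] by (metis imageI)
  qed
next
  fix H H' :: "(real ^ ('a + 'b)) set set"
  assume H: "H \<in> conf_quadratic_surfaces d" and "\<exists>g \<in> O_group. H' = proj_image g H"
  then obtain g where g: "g \<in> O_group" "H' = proj_image g H" by blast
  obtain h where h: "H = N_quadric \<inter> h" "h \<in> proj_subspaces (d + 1)"
    using H by (auto simp: conf_quadratic_surfaces_def)
  note gh = proj_image_proj_subspaces[OF O_groupD(1,2)[OF g(1)] h(2)]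
  have "subspace (underlying h)"
    using h(2) by (auto elim: proj_subspacesE)
  then obtain s where s: "has_signature Qhat (underlying h) s"
    using polar.signature_exists unfolding Qhat_eq_polar_form by blast
  have "polar.isometry g" "inj g"
    using g(1) O_groupD(2)[OF g(1)] by (simp_all add: O_group_iff_isometry bij_is_inj)
  from polar.has_signature_isometry_image[OF this s[unfolded Qhat_eq_polar_form]]
  have "has_signature Qhat (g ` underlying h) s"
    unfolding Qhat_eq_polar_form .
  with s have "has_signature Qhat (underlying h) s \<and> has_signature Qhat (underlying (proj_image g h)) s"
    by (simp add: gh(2))
  moreover have "H' = N_quadric \<inter> proj_image g h"
    using g h(1) by (simp add: proj_image_quadric_section)
  ultimately show "\<exists>h \<in> proj_subspaces (d + 1). \<exists>h' \<in> proj_subspaces (d + 1).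
      H = N_quadric \<inter> h \<and> H' = N_quadric \<inter> h' \<and>
      (\<exists>s. has_signature Qhat (underlying h) s \<and> has_signature Qhat (underlying h') s)"
    using h gh(1) by blast
next
  fix H H' :: "(real ^ ('a + 'b)) set set"
  assume "\<exists>h \<in> proj_subspaces (d + 1). \<exists>h' \<in> proj_subspaces (d + 1).
      H = N_quadric \<inter> h \<and> H' = N_quadric \<inter> h' \<and>
      (\<exists>s. has_signature Qhat (underlying h) s \<and> has_signature Qhat (underlying h') s)"
  then obtain h h' s where h: "h \<in> proj_subspaces (d + 1)" "H = N_quadric \<inter> h"
    "has_signature Qhat (underlying h) s"
    and h': "h' \<in> proj_subspaces (d + 1)" "H' = N_quadric \<inter> h'"
    "has_signature Qhat (underlying h') s"
    by blast
  obtain g where g: "polar.isometry g" "g ` underlying h = underlying h'"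
    using polar.isometry_between_subspaces_of_equal_signature
      h(3)[unfolded Qhat_eq_polar_form] h'(3)[unfolded Qhat_eq_polar_form] .
  have gO: "g \<in> O_group"
    using g(1) by (simp add: O_group_iff_isometry)
  obtain W where "h = {L \<in> proj_space. L \<subseteq> W}" "underlying h = W"
    using h(1) by (rule proj_subspacesE)
  moreover obtain W' where "h' = {L \<in> proj_space. L \<subseteq> W'}" "underlying h' = W'"
    using h'(1) by (rule proj_subspacesE)
  ultimately have "proj_image g h = h'"
    using g(2) proj_image_lines_in_subspace[OF O_groupD(1,2)[OF gO], of W] by simp
  then have "H' = proj_image g H"
    using h(2) h'(2) proj_image_quadric_section[OF gO] by simp
  then show "\<exists>g \<in> O_group. H' = proj_image g H"
    using gO by blast
qed

end
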